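(* Any minimal strongly regular time-like surface $\mathcal M:\ \mathbf z=\mathbf z(x,y)=(z_1,z_2,z_3)$, $(x,y)\in\mathcal D\subset\mathbb C$, in $\mathbb R^3_1$ (in the sense of the context), parameterized with canonical principal parameters, has locally a representation of the type $$(z_1)_x-i(z_1)_y=\frac12\,\frac{w^2+1}{w'},\qquad (z_2)_x-i(z_2)_y=-\frac i2\,\frac{w^2-1}{w'},\qquad (z_3)_x-i(z_3)_y=-\frac{w}{w'},$$ where $w=u(x,y)+iv(x,y)$ is a holomorphic function in $\mathbb C$ (i.e. a holomorphic function of the complex variable $x+iy$) satisfying the conditions $$u^2+v^2-1\neq0,\qquad \mu>0,\qquad \mu_x\mu_y\neq0,\qquad\text{where }\ \mu:=\frac{u_x^2+u_y^2}{(u^2+v^2-1)^2}.$$ Here $w'=u_x-iu_y$ is the complex derivative of $w$ with respect to $x+iy$.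
   Context: $\mathbb R^3_1$ is the three-dimensional Minkowski space, i.e. $\mathbb R^3$ with the inner product $\langle a,b\rangle=a_1b_1+a_2b_2-a_3b_3$, and $a^2:=\langle a,a\rangle$. Subscripts $x,y$ denote partial derivatives. The parameter plane is identified with $\mathbb C=\{x+iy\}$. A time-like surface here (the name refers to the causal character of its normal) is a surface $\mathbf z=\mathbf z(x,y)$, $(x,y)\in\mathcal D$, in $\mathbb R^3_1$ whose induced metric is positive definite, so that its unit normal $l$ satisfies $l^2=-1$. Put $E=\mathbf z_x^2$, $F=\langle\mathbf z_x,\mathbf z_y\rangle$, $G=\mathbf z_y^2$, $e=\langle\mathbf z_{xx},l\rangle$, $f=\langle\mathbf z_{xy},l\rangle$, $g=\langle\mathbf z_{yy},l\rangle$. Surfaces are supposed to have no umbilical points and to be parameterized by principal parameters, i.e. $F=f=0$ on $\mathcal D$. Put $X=\mathbf z_x/\sqrt E$, $Y=\mathbf z_y/\sqrt G$; the principal curvatures and principal geodesic curvatures are $$\nu_1=\frac eE,\quad \nu_2=\frac gG,\quad \gamma_1=-\frac{E_y}{2E\sqrt G},\quad \gamma_2=\frac{G_x}{2G\sqrt E}.$$ It is supposed that the frame $XYl$ is positively oriented and that $\nu_1-\nu_2>0$. The surface is strongly regular if $\gamma_1\gamma_2\neq0$ on $\mathcal D$, and minimal if $\nu_1+\nu_2=0$. For a minimal surface, $\nu:=\nu_1>0$ is the normal curvature function. Principal parameters $(x,y)$ of a minimal strongly regular surface are called canonical if $\mathbf z_x^2=\mathbf z_y^2=1/\nu$.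
   Formalization: Where l=(0,0,-1) no holomorphic w exists; there the representation is given on a punctured neighbourhood, with w having a pole. "XYl positively oriented" is read as l = Lorentzian vector product of X and Y (Euclidean determinant -1), as the printed signs require. *)

theory Defs
  imports "HOL-Complex_Analysis.Complex_Analysis"
begin

section \<open>Partial derivatives over the parameter plane\<close>

text \<open>The parameter plane is identified with the complex numbers, \<open>(x, y)\<close> being \<open>x + i y\<close>.\<close>

definition pdx :: "(complex \<Rightarrow> 'a::real_normed_vector) \<Rightarrow> complex \<Rightarrow> 'a" where
  "pdx f p = vector_derivative (\<lambda>t. f (p + complex_of_real t)) (at 0)"

definition pdy :: "(complex \<Rightarrow> 'a::real_normed_vector) \<Rightarrow> complex \<Rightarrow> 'a" where
  "pdy f p = vector_derivative (\<lambda>t. f (p + \<i> * complex_of_real t)) (at 0)"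

definition C1_on :: "(complex \<Rightarrow> 'a::real_normed_vector) \<Rightarrow> complex set \<Rightarrow> bool" where
  "C1_on f D \<longleftrightarrow> f differentiable_on D \<and> continuous_on D (pdx f) \<and> continuous_on D (pdy f)"

definition C2_on :: "(complex \<Rightarrow> 'a::real_normed_vector) \<Rightarrow> complex set \<Rightarrow> bool" where
  "C2_on f D \<longleftrightarrow> C1_on f D \<and> C1_on (pdx f) D \<and> C1_on (pdy f) D"

section \<open>Minkowski space\<close>

definition minner :: "real^3 \<Rightarrow> real^3 \<Rightarrow> real" where
  "minner a b = a$1 * b$1 + a$2 * b$2 - a$3 * b$3"

text \<open>The Lorentzian vector product, characterised by \<open>minner_mcross\<close> below.\<close>

definition mcross :: "real^3 \<Rightarrow> real^3 \<Rightarrow> real^3" where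
  "mcross a b = vector [a$2 * b$3 - a$3 * b$2, a$3 * b$1 - a$1 * b$3, a$2 * b$1 - a$1 * b$2]"

lemma minner_mcross: "minner (mcross a b) c = det (vector [a, b, c] :: real^3^3)"
  by (simp add: minner_def mcross_def det_3 algebra_simps)

section \<open>Surfaces with time-like normal\<close>

definition coeff_E :: "(complex \<Rightarrow> real^3) \<Rightarrow> complex \<Rightarrow> real" where
  "coeff_E z p = minner (pdx z p) (pdx z p)"

definition coeff_F :: "(complex \<Rightarrow> real^3) \<Rightarrow> complex \<Rightarrow> real" where
  "coeff_F z p = minner (pdx z p) (pdy z p)"

definition coeff_G :: "(complex \<Rightarrow> real^3) \<Rightarrow> complex \<Rightarrow> real" where
  "coeff_G z p = minner (pdy z p) (pdy z p)"

definition coeff_e :: "(complex \<Rightarrow> real^3) \<Rightarrow> (complex \<Rightarrow> real^3) \<Rightarrow> complex \<Rightarrow> real" where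
  "coeff_e z l p = minner (pdx (pdx z) p) (l p)"

definition coeff_f :: "(complex \<Rightarrow> real^3) \<Rightarrow> (complex \<Rightarrow> real^3) \<Rightarrow> complex \<Rightarrow> real" where
  "coeff_f z l p = minner (pdy (pdx z) p) (l p)"

definition coeff_g :: "(complex \<Rightarrow> real^3) \<Rightarrow> (complex \<Rightarrow> real^3) \<Rightarrow> complex \<Rightarrow> real" where
  "coeff_g z l p = minner (pdy (pdy z) p) (l p)"

text \<open>The surface \<open>z\<close> on \<open>D\<close> with unit normal field \<open>l\<close>; \<open>C\<^sup>2\<close> is the least regularity for which
  all the invariants below are defined.\<close>

definition timelike_surface ::
    "(complex \<Rightarrow> real^3) \<Rightarrow> (complex \<Rightarrow> real^3) \<Rightarrow> complex set \<Rightarrow> bool" where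
  "timelike_surface z l D \<longleftrightarrow>
     open D \<and> C2_on z D \<and>
     (\<forall>p\<in>D. \<forall>a b::real. (a, b) \<noteq> (0, 0) \<longrightarrow>
        coeff_E z p * a\<^sup>2 + 2 * coeff_F z p * a * b + coeff_G z p * b\<^sup>2 > 0) \<and>
     (\<forall>p\<in>D. minner (l p) (pdx z p) = 0 \<and> minner (l p) (pdy z p) = 0 \<and> minner (l p) (l p) = -1)"

definition frame_X :: "(complex \<Rightarrow> real^3) \<Rightarrow> complex \<Rightarrow> real^3" where
  "frame_X z p = (1 / sqrt (coeff_E z p)) *\<^sub>R pdx z p"

definition frame_Y :: "(complex \<Rightarrow> real^3) \<Rightarrow> complex \<Rightarrow> real^3" where
  "frame_Y z p = (1 / sqrt (coeff_G z p)) *\<^sub>R pdy z p"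

definition nu1 :: "(complex \<Rightarrow> real^3) \<Rightarrow> (complex \<Rightarrow> real^3) \<Rightarrow> complex \<Rightarrow> real" where
  "nu1 z l p = coeff_e z l p / coeff_E z p"

definition nu2 :: "(complex \<Rightarrow> real^3) \<Rightarrow> (complex \<Rightarrow> real^3) \<Rightarrow> complex \<Rightarrow> real" where
  "nu2 z l p = coeff_g z l p / coeff_G z p"

definition gamma1 :: "(complex \<Rightarrow> real^3) \<Rightarrow> complex \<Rightarrow> real" where
  "gamma1 z p = - pdy (coeff_E z) p / (2 * coeff_E z p * sqrt (coeff_G z p))"

definition gamma2 :: "(complex \<Rightarrow> real^3) \<Rightarrow> complex \<Rightarrow> real" where
  "gamma2 z p = pdx (coeff_G z) p / (2 * coeff_G z p * sqrt (coeff_E z p))"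

text \<open>Orientation convention: an orthonormal frame \<open>X, Y, l\<close> with \<open>l\<close> time-like is positively
  oriented when \<open>l\<close> is the Lorentzian vector product of \<open>X\<close> and \<open>Y\<close>. By \<open>minner_mcross\<close> the
  Euclidean determinant of such a frame is \<open>minner l l = -1\<close>. This is the convention that matches
  the sign of the third coordinate in the representation formula: for every \<open>w\<close>, the formula
  together with \<open>nu1 > 0\<close> forces that determinant to be \<open>-1\<close>.\<close>

definition positively_oriented_frame :: "real^3 \<Rightarrow> real^3 \<Rightarrow> real^3 \<Rightarrow> bool" where
  "positively_oriented_frame X Y l \<longleftrightarrow> mcross X Y = l"

text \<open>The last condition excludes umbilical points.\<close>

definition principal_parameters ::
    "(complex \<Rightarrow> real^3) \<Rightarrow> (complex \<Rightarrow> real^3) \<Rightarrow> complex set \<Rightarrow> bool" where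
  "principal_parameters z l D \<longleftrightarrow>
     (\<forall>p\<in>D. coeff_F z p = 0 \<and> coeff_f z l p = 0 \<and>
        positively_oriented_frame (frame_X z p) (frame_Y z p) (l p) \<and>
        nu1 z l p - nu2 z l p > 0)"

definition strongly_regular :: "(complex \<Rightarrow> real^3) \<Rightarrow> complex set \<Rightarrow> bool" where
  "strongly_regular z D \<longleftrightarrow> (\<forall>p\<in>D. gamma1 z p * gamma2 z p \<noteq> 0)"

definition minimal_surface ::
    "(complex \<Rightarrow> real^3) \<Rightarrow> (complex \<Rightarrow> real^3) \<Rightarrow> complex set \<Rightarrow> bool" where
  "minimal_surface z l D \<longleftrightarrow> (\<forall>p\<in>D. nu1 z l p + nu2 z l p = 0)"

definition canonical_parameters ::
    "(complex \<Rightarrow> real^3) \<Rightarrow> (complex \<Rightarrow> real^3) \<Rightarrow> complex set \<Rightarrow> bool" where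
  "canonical_parameters z l D \<longleftrightarrow>
     (\<forall>p\<in>D. minner (pdx z p) (pdx z p) = 1 / nu1 z l p \<and>
             minner (pdy z p) (pdy z p) = 1 / nu1 z l p)"

section \<open>The representation formula\<close>

definition mu :: "(complex \<Rightarrow> complex) \<Rightarrow> complex \<Rightarrow> real" where
  "mu w p = ((pdx (\<lambda>q. Re (w q)) p)\<^sup>2 + (pdy (\<lambda>q. Re (w q)) p)\<^sup>2)
              / ((Re (w p))\<^sup>2 + (Im (w p))\<^sup>2 - 1)\<^sup>2"

definition complex_gradient :: "(complex \<Rightarrow> real) \<Rightarrow> complex \<Rightarrow> complex" where
  "complex_gradient h p = complex_of_real (pdx h p) - \<i> * complex_of_real (pdy h p)"

definition canonical_representation ::
    "(complex \<Rightarrow> real^3) \<Rightarrow> (complex \<Rightarrow> complex) \<Rightarrow> complex set \<Rightarrow> bool" where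
  "canonical_representation z w U \<longleftrightarrow>
     w holomorphic_on U \<and>
     (\<forall>p\<in>U.
        (Re (w p))\<^sup>2 + (Im (w p))\<^sup>2 - 1 \<noteq> 0 \<and>
        mu w p > 0 \<and>
        pdx (mu w) p * pdy (mu w) p \<noteq> 0 \<and>
        complex_gradient (\<lambda>q. z q $ 1) p = 1 / 2 * (((w p)\<^sup>2 + 1) / deriv w p) \<and>
        complex_gradient (\<lambda>q. z q $ 2) p = - (\<i> / 2) * (((w p)\<^sup>2 - 1) / deriv w p) \<and>
        complex_gradient (\<lambda>q. z q $ 3) p = - (w p / deriv w p))"

text \<open>The function \<open>w\<close> is determined by \<open>z\<close>: it is the normal \<open>l\<close> followed by a stereographic
  projection, \<open>l = (2u, 2v, -(u\<^sup>2 + v\<^sup>2 + 1)) / (u\<^sup>2 + v\<^sup>2 - 1)\<close>, and \<open>l = (0, 0, -1)\<close> corresponds to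
  \<open>w = \<infinity>\<close>.\<close>

definition stereographic_pole :: "real^3" where
  "stereographic_pole = vector [0, 0, -1]"

end

theory Submission
  imports Defs
begin

text \<open>Conformality and \<open>\<nu>\<^sub>1 + \<nu>\<^sub>2 = 0\<close> make \<open>z\<close> harmonic, so the functions
  \<open>\<phi>\<^sub>j = (z\<^sub>j)\<^sub>x - i (z\<^sub>j)\<^sub>y\<close> are holomorphic, with \<open>\<phi>\<^sub>1\<^sup>2 + \<phi>\<^sub>2\<^sup>2 = \<phi>\<^sub>3\<^sup>2\<close>. Put
  \<open>h = \<phi>\<^sub>1 - i \<phi>\<^sub>2\<close> and \<open>w = - \<phi>\<^sub>3 / h\<close>; then \<open>\<phi> = h ((w\<^sup>2 + 1) / 2, - i (w\<^sup>2 - 1) / 2, - w)\<close> and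
  \<open>l\<close> is the stereographic image of \<open>w\<close>. Canonical parameters give \<open>e = 1\<close> and \<open>f = 0\<close>, that is
  \<open>\<langle>\<phi>', l\<rangle> = 1\<close>, and computing this product in terms of \<open>h\<close> and \<open>w\<close> yields \<open>h w' = 1\<close>, which is
  the representation. Moreover \<open>4 E = |h|\<^sup>2 (|w|\<^sup>2 - 1)\<^sup>2\<close>, hence \<open>\<mu> = 1 / (4 E)\<close> and
  \<open>\<mu>\<^sub>x \<mu>\<^sub>y \<noteq> 0\<close> is strong regularity. Finally \<open>h\<close> vanishes exactly where \<open>l = (0, 0, -1)\<close>; there
  \<open>\<phi>\<^sub>3\<close> has a simple zero, and \<open>w = - (\<phi>\<^sub>1 + i \<phi>\<^sub>2) / \<phi>\<^sub>3\<close> has a pole.\<close>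

section \<open>Partial derivatives\<close>

text \<open>Chain rule along the horizontal line through \<open>p\<close>. The first claim is kept
  separately because \<open>vector_derivative\<close> is a choice operator, whose value alone does
  not give differentiability.\<close>

lemma has_derivative_pdx:
  assumes "(f has_derivative f') (at p)"
  shows "((\<lambda>t. f (p + complex_of_real t)) has_vector_derivative f' 1) (at 0)"
    and "pdx f p = f' 1"
proof -
  have "((\<lambda>t. p + complex_of_real t) has_derivative (\<lambda>t. complex_of_real t)) (at 0)"
    by (auto intro!: derivative_eq_intros)
  moreover have "(f has_derivative f') (at (p + complex_of_real 0))"
    using assms by simp
  ultimately have "((\<lambda>t. f (p + complex_of_real t)) has_derivative (\<lambda>t. f' (complex_of_real t))) (at 0)"
    by (rule has_derivative_compose)
  moreover have "(\<lambda>t. f' (complex_of_real t)) = (\<lambda>t. t *\<^sub>R f' 1)"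
    using linear_scale[OF has_derivative_linear[OF assms], of _ 1] by (simp add: scaleR_conv_of_real)
  ultimately show *: "((\<lambda>t. f (p + complex_of_real t)) has_vector_derivative f' 1) (at 0)"
    by (simp add: has_vector_derivative_def)
  show "pdx f p = f' 1"
    unfolding pdx_def using * by (rule vector_derivative_at)
qed

lemma has_derivative_pdy:
  assumes "(f has_derivative f') (at p)"
  shows "((\<lambda>t. f (p + \<i> * complex_of_real t)) has_vector_derivative f' \<i>) (at 0)"
    and "pdy f p = f' \<i>"
proof -
  have "((\<lambda>t. p + \<i> * complex_of_real t) has_derivative (\<lambda>t. \<i> * complex_of_real t)) (at 0)"
    by (auto intro!: derivative_eq_intros)
  moreover have "(f has_derivative f') (at (p + \<i> * complex_of_real 0))"
    using assms by simp
  ultimately have "((\<lambda>t. f (p + \<i> * complex_of_real t)) has_derivative (\<lambda>t. f' (\<i> * complex_of_real t))) (at 0)"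
    by (rule has_derivative_compose)
  moreover have "(\<lambda>t. f' (\<i> * complex_of_real t)) = (\<lambda>t. t *\<^sub>R f' \<i>)"
    using linear_scale[OF has_derivative_linear[OF assms], of _ \<i>]
    by (simp add: scaleR_conv_of_real mult.commute)
  ultimately show *: "((\<lambda>t. f (p + \<i> * complex_of_real t)) has_vector_derivative f' \<i>) (at 0)"
    by (simp add: has_vector_derivative_def)
  show "pdy f p = f' \<i>"
    unfolding pdy_def using * by (rule vector_derivative_at)
qed

text \<open>A real-linear map on the complex plane is fixed by its values at 1 and
  \<open>\<i>\<close>. In this form the rules for total derivatives carry over to \<open>pdx\<close>
  and \<open>pdy\<close>.\<close>

lemma has_derivative_partials:
  assumes "f differentiable (at p)"
  shows "(f has_derivative (\<lambda>h. Re h *\<^sub>R pdx f p + Im h *\<^sub>R pdy f p)) (at p)"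
proof -
  obtain f' where f': "(f has_derivative f') (at p)"
    using assms by (auto simp: differentiable_def)
  note lin = has_derivative_linear[OF f']
  have "f' h = Re h *\<^sub>R pdx f p + Im h *\<^sub>R pdy f p" for h
  proof -
    have "h = Re h *\<^sub>R 1 + Im h *\<^sub>R \<i>"
      by (simp add: complex_eq_iff)
    then have "f' h = Re h *\<^sub>R f' 1 + Im h *\<^sub>R f' \<i>"
      using linear_add[OF lin] linear_scale[OF lin] by metis
    then show ?thesis
      by (simp add: has_derivative_pdx(2)[OF f'] has_derivative_pdy(2)[OF f'])
  qed
  then have "f' = (\<lambda>h. Re h *\<^sub>R pdx f p + Im h *\<^sub>R pdy f p)"
    by auto
  with f' show ?thesis by simp
qed

text \<open>Partial derivatives depend only on values near \<open>p\<close>, so identities valid on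
  an open set, such as \<open>F = 0\<close> and \<open>G = E\<close> on \<open>D\<close>, can be
  differentiated.\<close>

lemma partials_cong:
  assumes "open U" "p \<in> U" "\<And>q. q \<in> U \<Longrightarrow> f q = g q"
  shows "pdx f p = pdx g p" and "pdy f p = pdy g p"
proof -
  have "((\<lambda>t. p + complex_of_real t) \<longlongrightarrow> p + complex_of_real 0) (nhds 0)"
    by (intro tendsto_intros filterlim_ident)
  then have "\<forall>\<^sub>F t in nhds 0. p + complex_of_real t \<in> U"
    using assms(1,2) by (auto intro: topological_tendstoD)
  then have "\<forall>\<^sub>F t in nhds 0. f (p + complex_of_real t) = g (p + complex_of_real t)"
    by eventually_elim (rule assms(3))
  then show "pdx f p = pdx g p"
    unfolding pdx_def by (intro vector_derivative_cong_eq) auto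
  have "((\<lambda>t. p + \<i> * complex_of_real t) \<longlongrightarrow> p + \<i> * complex_of_real 0) (nhds 0)"
    by (intro tendsto_intros filterlim_ident)
  then have "\<forall>\<^sub>F t in nhds 0. p + \<i> * complex_of_real t \<in> U"
    using assms(1,2) by (auto intro: topological_tendstoD)
  then have "\<forall>\<^sub>F t in nhds 0. f (p + \<i> * complex_of_real t) = g (p + \<i> * complex_of_real t)"
    by eventually_elim (rule assms(3))
  then show "pdy f p = pdy g p"
    unfolding pdy_def by (intro vector_derivative_cong_eq) auto
qed

lemma partials_bounded_linear:
  assumes "bounded_linear L" "f differentiable (at p)"
  shows "(\<lambda>q. L (f q)) differentiable (at p)"
    and "pdx (\<lambda>q. L (f q)) p = L (pdx f p)"
    and "pdy (\<lambda>q. L (f q)) p = L (pdy f p)"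
proof -
  have *: "((\<lambda>q. L (f q)) has_derivative (\<lambda>h. L (Re h *\<^sub>R pdx f p + Im h *\<^sub>R pdy f p))) (at p)"
    by (rule bounded_linear.has_derivative[OF assms(1) has_derivative_partials[OF assms(2)]])
  show "(\<lambda>q. L (f q)) differentiable (at p)"
    using * by (auto simp: differentiable_def)
  show "pdx (\<lambda>q. L (f q)) p = L (pdx f p)" "pdy (\<lambda>q. L (f q)) p = L (pdy f p)"
    using has_derivative_pdx(2)[OF *] has_derivative_pdy(2)[OF *] by simp_all
qed

lemma bounded_bilinear_minner: "bounded_bilinear minner"
proof
  show "\<exists>K. \<forall>a b. norm (minner a b) \<le> norm a * norm b * K"
  \<comment> \<open>The product has three terms, each bounded by
    \<open>norm a * norm b\<close>.\<close>
  proof (intro exI[of _ 3] allI)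
    fix a b :: "real^3"
    have *: "\<bar>a$i * b$i\<bar> \<le> norm a * norm b" for i
      by (simp add: abs_mult mult_mono component_le_norm_cart)
    show "norm (minner a b) \<le> norm a * norm b * 3"
      using *[of 1] *[of 2] *[of 3] unfolding minner_def by (simp add: abs_le_iff)
  qed
qed (simp_all add: minner_def algebra_simps)

lemma partials_minner:
  assumes "f differentiable (at p)" "g differentiable (at p)"
  shows "(\<lambda>q. minner (f q) (g q)) differentiable (at p)"
    and "pdx (\<lambda>q. minner (f q) (g q)) p = minner (f p) (pdx g p) + minner (pdx f p) (g p)"
    and "pdy (\<lambda>q. minner (f q) (g q)) p = minner (f p) (pdy g p) + minner (pdy f p) (g p)"
proof -
  note * = bounded_bilinear.FDERIV[OF bounded_bilinear_minner
      has_derivative_partials[OF assms(1)] has_derivative_partials[OF assms(2)]]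
  show "(\<lambda>q. minner (f q) (g q)) differentiable (at p)"
    using * by (auto simp: differentiable_def)
  show "pdx (\<lambda>q. minner (f q) (g q)) p = minner (f p) (pdx g p) + minner (pdx f p) (g p)"
    and "pdy (\<lambda>q. minner (f q) (g q)) p = minner (f p) (pdy g p) + minner (pdy f p) (g p)"
    using has_derivative_pdx(2)[OF *] has_derivative_pdy(2)[OF *] by simp_all
qed

lemma C1_onD:
  assumes "C1_on f D" "open D" "p \<in> D"
  shows "f differentiable (at p)" "isCont (pdx f) p" "isCont (pdy f) p"
proof -
  show "f differentiable (at p)"
    using assms by (simp add: C1_on_def differentiable_on_eq_differentiable_at)
  show "isCont (pdx f) p" "isCont (pdy f) p"
    using assms by (simp_all add: C1_on_def continuous_on_eq_continuous_at)
qed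

lemma C2_onD:
  assumes "C2_on f D" "open D" "p \<in> D"
  shows "f differentiable (at p)" "pdx f differentiable (at p)" "pdy f differentiable (at p)"
  using assms C1_onD(1) unfolding C2_on_def by blast+

section \<open>Symmetry of the mixed partial derivatives\<close>

lemma mean_value_pdx:
  fixes f :: "complex \<Rightarrow> real"
  assumes "0 < s" "\<And>t. \<lbrakk>0 \<le> t; t \<le> s\<rbrakk> \<Longrightarrow> f differentiable (at (q + complex_of_real t))"
  shows "\<exists>t. 0 < t \<and> t < s \<and> f (q + complex_of_real s) - f q = s * pdx f (q + complex_of_real t)"
proof -
  have "((\<lambda>t. f (q + complex_of_real t)) has_real_derivative pdx f (q + complex_of_real t)) (at t)"
    if "0 \<le> t" "t \<le> s" for t
  proof -
    have "((\<lambda>r. f ((q + complex_of_real t) + complex_of_real r)) has_vector_derivative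
            pdx f (q + complex_of_real t)) (at 0)"
      using has_derivative_pdx(1)[OF has_derivative_partials[OF assms(2)[OF that]]] by simp
    then have "((\<lambda>r. f (q + complex_of_real (r + t))) has_real_derivative
            pdx f (q + complex_of_real t)) (at 0)"
      by (simp add: has_real_derivative_iff_has_vector_derivative algebra_simps)
    then show ?thesis
      using DERIV_shift[of "\<lambda>t. f (q + complex_of_real t)" _ 0 t] by simp
  qed
  from MVT2[OF assms(1) this] show ?thesis by auto
qed

lemma mean_value_pdy:
  fixes f :: "complex \<Rightarrow> real"
  assumes "0 < s" "\<And>t. \<lbrakk>0 \<le> t; t \<le> s\<rbrakk> \<Longrightarrow> f differentiable (at (q + \<i> * complex_of_real t))"
  shows "\<exists>t. 0 < t \<and> t < s \<and> f (q + \<i> * complex_of_real s) - f q = s * pdy f (q + \<i> * complex_of_real t)"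
proof -
  have "((\<lambda>t. f (q + \<i> * complex_of_real t)) has_real_derivative pdy f (q + \<i> * complex_of_real t)) (at t)"
    if "0 \<le> t" "t \<le> s" for t
  proof -
    have "((\<lambda>r. f ((q + \<i> * complex_of_real t) + \<i> * complex_of_real r)) has_vector_derivative
            pdy f (q + \<i> * complex_of_real t)) (at 0)"
      using has_derivative_pdy(1)[OF has_derivative_partials[OF assms(2)[OF that]]] by simp
    then have "((\<lambda>r. f (q + \<i> * complex_of_real (r + t))) has_real_derivative
            pdy f (q + \<i> * complex_of_real t)) (at 0)"
      by (simp add: has_real_derivative_iff_has_vector_derivative algebra_simps)
    then show ?thesis
      using DERIV_shift[of "\<lambda>t. f (q + \<i> * complex_of_real t)" _ 0 t] by simp
  qed
  from MVT2[OF assms(1) this] show ?thesis by auto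
qed

lemma partials_shift:
  "pdx (\<lambda>q. f (q + c)) p = pdx f (p + c)" "pdy (\<lambda>q. f (q + c)) p = pdy f (p + c)"
  by (simp_all add: pdx_def pdy_def algebra_simps)

lemma differentiable_shift:
  fixes f :: "complex \<Rightarrow> 'a::real_normed_vector"
  assumes "f differentiable (at (p + c))"
  shows "(\<lambda>q. f (q + c)) differentiable (at p)"
  by (rule differentiable_compose[of f "\<lambda>q. q + c", OF assms]) simp

lemma partials_diff:
  fixes f g :: "complex \<Rightarrow> real"
  assumes "f differentiable (at p)" "g differentiable (at p)"
  shows "pdx (\<lambda>q. f q - g q) p = pdx f p - pdx g p" "pdy (\<lambda>q. f q - g q) p = pdy f p - pdy g p"
proof -
  note * = has_derivative_diff[OF has_derivative_partials[OF assms(1)] has_derivative_partials[OF assms(2)]]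
  show "pdx (\<lambda>q. f q - g q) p = pdx f p - pdx g p" "pdy (\<lambda>q. f q - g q) p = pdy f p - pdy g p"
    using has_derivative_pdx(2)[OF *] has_derivative_pdy(2)[OF *] by simp_all
qed

text \<open>Both mixed partials are attained as the second difference quotient over the square with
  side \<open>s\<close>, so they agree at points that tend to \<open>p\<close> with \<open>s\<close>.\<close>

lemma mixed_partials_commute_real:
  fixes f :: "complex \<Rightarrow> real"
  assumes D: "open D" "p \<in> D" and C2: "C2_on f D"
  shows "pdy (pdx f) p = pdx (pdy f) p"
proof (rule ccontr)
  assume "pdy (pdx f) p \<noteq> pdx (pdy f) p"
  \<comment> \<open>Half the gap: values strictly within \<open>e\<close> of the one and of the
    other mixed partial at \<open>p\<close> cannot coincide.\<close>
  define e where "e = \<bar>pdy (pdx f) p - pdx (pdy f) p\<bar> / 2"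
  with \<open>pdy (pdx f) p \<noteq> pdx (pdy f) p\<close>
  have e: "e > 0" "e = \<bar>pdy (pdx f) p - pdx (pdy f) p\<bar> / 2"
    by simp_all
  note C1 = C2[unfolded C2_on_def]
  have "\<forall>\<^sub>F q in nhds p. dist (pdy (pdx f) q) (pdy (pdx f) p) < e"
    using C1_onD(3)[of "pdx f" D p] C1 D e(1) by (simp add: isCont_def tendsto_at_iff_tendsto_nhds tendstoD)
  moreover have "\<forall>\<^sub>F q in nhds p. dist (pdx (pdy f) q) (pdx (pdy f) p) < e"
    using C1_onD(2)[of "pdy f" D p] C1 D e(1) by (simp add: isCont_def tendsto_at_iff_tendsto_nhds tendstoD)
  moreover have "\<forall>\<^sub>F q in nhds p. q \<in> D"
    using D by (auto simp: eventually_nhds)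
  ultimately have "\<forall>\<^sub>F q in nhds p. q \<in> D \<and> dist (pdy (pdx f) q) (pdy (pdx f) p) < e
      \<and> dist (pdx (pdy f) q) (pdx (pdy f) p) < e"
    by eventually_elim auto
  then obtain r where r: "r > 0" "\<And>q. dist q p < r \<Longrightarrow> q \<in> D \<and> dist (pdy (pdx f) q) (pdy (pdx f) p) < e
      \<and> dist (pdx (pdy f) q) (pdx (pdy f) p) < e"
    by (auto simp: eventually_nhds_metric)
  \<comment> \<open>Points of the square with corner \<open>p\<close> and side \<open>s\<close> lie
    within \<open>2 * s\<close> of \<open>p\<close> by the triangle inequality, and this is below
    \<open>r\<close>.\<close>
  define s where "s = r / 3"
  have s: "s > 0" "2 * s < r" using r(1) by (auto simp: s_def)
  have near: "dist (p + complex_of_real t + \<i> * complex_of_real t') p < r"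
    if "0 \<le> t" "t \<le> s" "0 \<le> t'" "t' \<le> s" for t t'
    using that s norm_triangle_ineq[of "complex_of_real t" "\<i> * complex_of_real t'"]
    by (simp add: dist_norm norm_mult)
  have inD: "p + complex_of_real t + \<i> * complex_of_real t' \<in> D"
    if "0 \<le> t" "t \<le> s" "0 \<le> t'" "t' \<le> s" for t t'
    using r(2)[OF near[OF that]] by simp
  have diff: "f differentiable (at q)" "pdx f differentiable (at q)" "pdy f differentiable (at q)"
    if "q \<in> D" for q
    using C2_onD[OF C2 D(1) that] by auto
  define S where "S = f (p + complex_of_real s + \<i> * complex_of_real s) - f (p + complex_of_real s)
     - (f (p + \<i> * complex_of_real s) - f p)"
  \<comment> \<open>\<open>S\<close> is the horizontal increment of a vertical difference of
    \<open>f\<close>. The mean value theorem in \<open>x\<close>, then in \<open>y\<close>, turns it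
    into a value of \<open>pdy (pdx f)\<close>.\<close>
  have "\<exists>q. dist q p < r \<and> S = s * (s * pdy (pdx f) q)"
  proof -
    have d: "f differentiable (at (p + complex_of_real t))"
      "f differentiable (at (p + complex_of_real t + \<i> * complex_of_real s))"
      if "0 \<le> t" "t \<le> s" for t
      using inD[of t 0] inD[of t s] that s by (auto intro: diff)
    have "(\<lambda>q. f (q + \<i> * complex_of_real s) - f q) differentiable (at (p + complex_of_real t))"
      if "0 \<le> t" "t \<le> s" for t
      using d[OF that] by (intro differentiable_diff differentiable_shift)
    from mean_value_pdx[OF s(1) this] obtain t where t: "0 < t" "t < s"
      "S = s * pdx (\<lambda>q. f (q + \<i> * complex_of_real s) - f q) (p + complex_of_real t)"
      by (auto simp: S_def)
    have "pdx (\<lambda>q. f (q + \<i> * complex_of_real s) - f q) (p + complex_of_real t)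
        = pdx f (p + complex_of_real t + \<i> * complex_of_real s) - pdx f (p + complex_of_real t)"
      using d[of t] t by (subst partials_diff) (auto intro!: differentiable_shift simp: partials_shift)
    moreover obtain t' where "0 < t'" "t' < s"
      "pdx f (p + complex_of_real t + \<i> * complex_of_real s) - pdx f (p + complex_of_real t)
        = s * pdy (pdx f) (p + complex_of_real t + \<i> * complex_of_real t')"
      using mean_value_pdy[of s "pdx f" "p + complex_of_real t"] s(1) inD[of t] t diff(2)
      by auto
    ultimately show ?thesis
      using near[of t t'] t by auto
  qed
  then obtain q where q: "dist q p < r" "S = s * (s * pdy (pdx f) q)" by blast
  \<comment> \<open>The same \<open>S\<close>, read as the vertical increment of a horizontal
    difference, yields the other order of differentiation.\<close>
  have "\<exists>q. dist q p < r \<and> S = s * (s * pdx (pdy f) q)"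
  proof -
    have d: "f differentiable (at (p + \<i> * complex_of_real t))"
      "f differentiable (at (p + \<i> * complex_of_real t + complex_of_real s))"
      if "0 \<le> t" "t \<le> s" for t
      using inD[of 0 t] inD[of s t] that s by (auto intro: diff simp: add_ac)
    have "(\<lambda>q. f (q + complex_of_real s) - f q) differentiable (at (p + \<i> * complex_of_real t))"
      if "0 \<le> t" "t \<le> s" for t
      using d[OF that] by (intro differentiable_diff differentiable_shift)
    from mean_value_pdy[OF s(1) this] obtain t where t: "0 < t" "t < s"
      "S = s * pdy (\<lambda>q. f (q + complex_of_real s) - f q) (p + \<i> * complex_of_real t)"
      by (auto simp: S_def add_ac)
    have "pdy (\<lambda>q. f (q + complex_of_real s) - f q) (p + \<i> * complex_of_real t)
        = pdy f (p + \<i> * complex_of_real t + complex_of_real s) - pdy f (p + \<i> * complex_of_real t)"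
      using d[of t] t by (subst partials_diff) (auto intro!: differentiable_shift simp: partials_shift)
    moreover obtain t' where "0 < t'" "t' < s"
      "pdy f (p + \<i> * complex_of_real t + complex_of_real s) - pdy f (p + \<i> * complex_of_real t)
        = s * pdx (pdy f) (p + \<i> * complex_of_real t + complex_of_real t')"
      using mean_value_pdx[of s "pdy f" "p + \<i> * complex_of_real t"] s(1) inD[of _ t] t diff(3)
      by (auto simp: add_ac)
    ultimately show ?thesis
      using near[of t' t] t by (auto simp: add_ac)
  qed
  then obtain q' where q': "dist q' p < r" "S = s * (s * pdx (pdy f) q')" by blast
  have "pdy (pdx f) q = pdx (pdy f) q'"
    using q(2) q'(2) s(1) by simp
  with r(2)[OF q(1)] r(2)[OF q'(1)] e show False
    by (auto simp: dist_real_def abs_if split: if_splits)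
qed

lemma C1_on_nth:
  fixes f :: "complex \<Rightarrow> real^'n"
  assumes "open D" "C1_on f D"
  shows "C1_on (\<lambda>q. f q $ i) D"
proof -
  have d: "f differentiable (at q)" if "q \<in> D" for q
    using C1_onD(1)[OF assms(2,1) that] .
  note L = partials_bounded_linear[OF bounded_linear_vec_nth[of i] d]
  have "continuous_on D (pdx (\<lambda>q. f q $ i)) = continuous_on D (\<lambda>q. pdx f q $ i)"
    "continuous_on D (pdy (\<lambda>q. f q $ i)) = continuous_on D (\<lambda>q. pdy f q $ i)"
    using L(2,3) by (intro continuous_on_cong refl; simp)+
  moreover have "(\<lambda>q. f q $ i) differentiable_on D"
    using L(1) by (auto simp: differentiable_on_def intro: differentiable_at_withinI)
  ultimately show ?thesis
    using assms(2) unfolding C1_on_def by (auto intro!: continuous_intros)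
qed

text \<open>\<open>pdx (\<lambda>q. f q $ i)\<close> and \<open>\<lambda>q. pdx f q $ i\<close> are
  known to agree only on \<open>D\<close>, where \<open>f\<close> is differentiable. Regularity is
  moved across such an equality here.\<close>

lemma C1_on_cong:
  assumes "open D" "\<And>q. q \<in> D \<Longrightarrow> f q = g q"
  shows "C1_on f D \<longleftrightarrow> C1_on g D"
proof -
  have "f differentiable_on D \<longleftrightarrow> g differentiable_on D"
    using assms(2) by (auto simp: differentiable_on_def intro: differentiable_transform_within[OF _ zero_less_one])
  moreover have "continuous_on D (pdx f) = continuous_on D (pdx g)"
    "continuous_on D (pdy f) = continuous_on D (pdy g)"
    using partials_cong[of D _ f g] assms by (intro continuous_on_cong refl; simp)+
  ultimately show ?thesis by (simp add: C1_on_def)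
qed

lemma C2_on_nth:
  fixes f :: "complex \<Rightarrow> real^'n"
  assumes "open D" "C2_on f D"
  shows "C2_on (\<lambda>q. f q $ i) D"
proof -
  have d: "f differentiable (at q)" if "q \<in> D" for q
    using C2_onD(1)[OF assms(2,1) that] .
  note L = partials_bounded_linear[OF bounded_linear_vec_nth[of i] d]
  have "C1_on (pdx (\<lambda>q. f q $ i)) D = C1_on (\<lambda>q. pdx f q $ i) D"
    "C1_on (pdy (\<lambda>q. f q $ i)) D = C1_on (\<lambda>q. pdy f q $ i) D"
    using L(2,3) by (intro C1_on_cong assms(1); simp)+
  then show ?thesis
    using assms C1_on_nth unfolding C2_on_def by auto
qed

lemma mixed_partials_commute:
  fixes f :: "complex \<Rightarrow> real^'n"
  assumes "open D" "p \<in> D" "C2_on f D"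
  shows "pdy (pdx f) p = pdx (pdy f) p"
proof (rule vec_eq_iff[THEN iffD2], rule allI)
  fix i
  have d: "f differentiable (at q)" "pdx f differentiable (at q)" "pdy f differentiable (at q)"
    if "q \<in> D" for q
    using C2_onD[OF assms(3,1) that] by auto
  note L = partials_bounded_linear(2,3)[OF bounded_linear_vec_nth[of i]]
  have "pdy (pdx f) p $ i = pdy (\<lambda>q. pdx f q $ i) p"
    using L(2)[OF d(2)[OF assms(2)]] by simp
  also have "\<dots> = pdy (pdx (\<lambda>q. f q $ i)) p"
    using L(1)[OF d(1)] by (intro partials_cong[OF assms(1,2)]) simp
  also have "\<dots> = pdx (pdy (\<lambda>q. f q $ i)) p"
    by (rule mixed_partials_commute_real[OF assms(1,2) C2_on_nth[OF assms(1,3)]])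
  also have "\<dots> = pdx (\<lambda>q. pdy f q $ i) p"
    using L(2)[OF d(1)] by (intro partials_cong[OF assms(1,2)]) simp
  also have "\<dots> = pdx (pdy f) p $ i"
    using L(1)[OF d(3)[OF assms(2)]] by simp
  finally show "pdy (pdx f) p $ i = pdx (pdy f) p $ i" .
qed

text \<open>The Cauchy-Riemann equations turn the real-linear total derivative into multiplication
  by a complex number.\<close>

lemma Cauchy_Riemann_has_field_derivative:
  fixes a b :: "complex \<Rightarrow> real"
  assumes "a differentiable (at p)" "b differentiable (at p)"
    and "pdx a p = pdy b p" "pdy a p = - pdx b p"
  shows "((\<lambda>q. Complex (a q) (b q)) has_field_derivative Complex (pdx a p) (pdx b p)) (at p)"
proof -
  have "((\<lambda>q. complex_of_real (a q) + \<i> * complex_of_real (b q)) has_derivative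
     (\<lambda>h. complex_of_real (Re h *\<^sub>R pdx a p + Im h *\<^sub>R pdy a p)
        + \<i> * complex_of_real (Re h *\<^sub>R pdx b p + Im h *\<^sub>R pdy b p))) (at p)"
    by (intro derivative_intros has_derivative_partials assms has_derivative_of_real)
  moreover have "(\<lambda>h. complex_of_real (Re h *\<^sub>R pdx a p + Im h *\<^sub>R pdy a p)
        + \<i> * complex_of_real (Re h *\<^sub>R pdx b p + Im h *\<^sub>R pdy b p)) = (*) (Complex (pdx a p) (pdx b p))"
    using assms(3,4) by (auto simp: fun_eq_iff complex_eq_iff algebra_simps)
  ultimately show ?thesis
    by (simp add: has_field_derivative_def Complex_eq)
qed

text \<open>Hence \<open>u_x^2 + u_y^2 = |w'|^2\<close>, which evaluates the numerator of
  \<open>mu\<close>.\<close>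

lemma has_field_derivative_partials_Re:
  assumes "(w has_field_derivative w') (at p)"
  shows "pdx (\<lambda>q. Re (w q)) p = Re w'" "pdy (\<lambda>q. Re (w q)) p = - Im w'"
proof -
  have *: "((\<lambda>q. Re (w q)) has_derivative (\<lambda>h. Re (w' * h))) (at p)"
    using assms unfolding has_field_derivative_def by (rule has_derivative_Re)
  show "pdx (\<lambda>q. Re (w q)) p = Re w'" "pdy (\<lambda>q. Re (w q)) p = - Im w'"
    using has_derivative_pdx(2)[OF *] has_derivative_pdy(2)[OF *] by simp_all
qed

lemma partials_inverse:
  fixes f :: "complex \<Rightarrow> real"
  assumes "f differentiable (at p)" "f p \<noteq> 0"
  shows "pdx (\<lambda>q. 1 / f q) p = - pdx f p / (f p)\<^sup>2" "pdy (\<lambda>q. 1 / f q) p = - pdy f p / (f p)\<^sup>2"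
proof -
  have *: "((\<lambda>q. inverse (f q)) has_derivative
     (\<lambda>h. - (inverse (f p) * (Re h *\<^sub>R pdx f p + Im h *\<^sub>R pdy f p) * inverse (f p)))) (at p)"
    by (rule Deriv.has_derivative_inverse[OF assms(2) has_derivative_partials[OF assms(1)]])
  show "pdx (\<lambda>q. 1 / f q) p = - pdx f p / (f p)\<^sup>2" "pdy (\<lambda>q. 1 / f q) p = - pdy f p / (f p)\<^sup>2"
    using has_derivative_pdx(2)[OF *] has_derivative_pdy(2)[OF *]
    by (simp_all add: divide_simps power2_eq_square)
qed

section \<open>Stereographic projection of the normal\<close>

lemma mcross_nth:
  "mcross a b $ 1 = a$2 * b$3 - a$3 * b$2"
  "mcross a b $ 2 = a$3 * b$1 - a$1 * b$3"
  "mcross a b $ 3 = a$2 * b$1 - a$1 * b$2"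
  by (simp_all add: mcross_def)

lemma mcross_scaleR: "mcross (c *\<^sub>R a) (d *\<^sub>R b) = (c * d) *\<^sub>R mcross a b"
  by (simp add: vec_eq_iff forall_3 mcross_nth algebra_simps)

text \<open>Lagrange's identity with the Lorentzian sign. For tangent vectors spanning a positive
  definite plane it shows that the product is time-like.\<close>

lemma minner_mcross_self:
  "minner (mcross a b) (mcross a b) = (minner a b)\<^sup>2 - minner a a * minner b b"
  by (simp add: minner_def mcross_nth algebra_simps power2_eq_square)

text \<open>Cramer's rule for the Gram equations of the frame \<open>a\<close>, \<open>b\<close>, \<open>mcross a b\<close>.\<close>

lemma minner_orthogonal_frame_eq_0:
  assumes "minner v a = 0" "minner v b = 0" "minner v (mcross a b) = 0"
    and "minner (mcross a b) (mcross a b) \<noteq> 0"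
  shows "v = 0"
proof -
  let ?l = "mcross a b"
  have "minner ?l ?l *\<^sub>R v = minner v a *\<^sub>R mcross b ?l + minner v b *\<^sub>R mcross ?l a + minner v ?l *\<^sub>R ?l"
    by (simp add: vec_eq_iff forall_3 minner_def mcross_nth algebra_simps)
  with assms show ?thesis by simp
qed

section \<open>Pointwise algebra, with \<open>a\<close>, \<open>b\<close>, \<open>n\<close> standing
  for \<open>z_x\<close>, \<open>z_y\<close>, \<open>l\<close> at one point\<close>

context
  fixes a b n :: "real^3" and E :: real and h :: complex
  assumes conformal: "minner a a = E" "minner b b = E" "minner a b = 0" and E_pos: "E > 0"
    and normal: "mcross a b = E *\<^sub>R n"
    and h_def: "h = Complex (a$1) (- b$1) - \<i> * Complex (a$2) (- b$2)"
begin

text \<open>The real part is \<open>minner a a = minner b b\<close>, the imaginary part is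
  \<open>minner a b = 0\<close>.\<close>

lemma isotropic:
  "(Complex (a$1) (- b$1))\<^sup>2 + (Complex (a$2) (- b$2))\<^sup>2 = (Complex (a$3) (- b$3))\<^sup>2"
  using conformal by (simp add: complex_eq_iff minner_def power2_eq_square algebra_simps)

text \<open>Isotropy factors as \<open>h * (A + \<i> * B) = C^2\<close>. With
  \<open>C = - (h * w)\<close> this gives \<open>A + \<i> * B = h * w^2\<close>, and
  \<open>A\<close>, \<open>B\<close> are recovered from this and
  \<open>A - \<i> * B = h\<close>.\<close>

lemma stereographic_components:
  assumes "h \<noteq> 0" and w: "w = - (Complex (a$3) (- b$3) / h)"
  shows "Complex (a$1) (- b$1) = h * (w\<^sup>2 + 1) / 2"
    and "Complex (a$2) (- b$2) = - (\<i> / 2) * (h * (w\<^sup>2 - 1))"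
    and "Complex (a$3) (- b$3) = - (h * w)"
proof -
  define A B C where "A = Complex (a$1) (- b$1)" "B = Complex (a$2) (- b$2)" "C = Complex (a$3) (- b$3)"
  have C: "C = - (h * w)" using assms by (simp add: A_B_C_def)
  have AB: "A\<^sup>2 + B\<^sup>2 = C\<^sup>2" unfolding A_B_C_def by (rule isotropic)
  have h: "h = A - \<i> * B" by (simp add: h_def A_B_C_def)
  have "h * (A + \<i> * B) = A\<^sup>2 + B\<^sup>2"
    by (simp add: h power2_eq_square algebra_simps)
  also have "\<dots> = h * (h * w\<^sup>2)"
    unfolding AB C by (simp add: power2_eq_square)
  finally have *: "A + \<i> * B = h * w\<^sup>2" using \<open>h \<noteq> 0\<close> by simp
  have "A = (h + (A + \<i> * B)) / 2" by (simp add: h)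
  then show "Complex (a$1) (- b$1) = h * (w\<^sup>2 + 1) / 2"
    unfolding * by (simp add: A_B_C_def algebra_simps)
  have "B = - (\<i> / 2) * ((A + \<i> * B) - h)" by (simp add: h algebra_simps)
  then show "Complex (a$2) (- b$2) = - (\<i> / 2) * (h * (w\<^sup>2 - 1))"
    unfolding * by (simp add: A_B_C_def algebra_simps)
  show "Complex (a$3) (- b$3) = - (h * w)" using C by (simp add: A_B_C_def)
qed

text \<open>Expansion in real coordinates, \<open>w = u + iv\<close>, gives
  \<open>mcross a b = (|h|^2 m / 4) (2u, 2v, -(m + 2))\<close>. Division by
  \<open>E = |h|^2 m^2 / 4\<close> turns this into the inverse stereographic projection of
  \<open>w\<close>; positivity of \<open>E\<close> excludes \<open>m = 0\<close>.\<close>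

lemma stereographic_normal:
  assumes "h \<noteq> 0" and w: "w = - (Complex (a$3) (- b$3) / h)"
  defines "m \<equiv> (Re w)\<^sup>2 + (Im w)\<^sup>2 - 1"
  shows "4 * E = (cmod h)\<^sup>2 * m\<^sup>2" and "m \<noteq> 0"
    and "m * n$1 = 2 * Re w" and "m * n$2 = 2 * Im w" and "m * n$3 = - (m + 2)"
proof -
  define p q u v where pquv: "p = Re h" "q = Im h" "u = Re w" "v = Im w"
  note c = stereographic_components[OF assms(1,2)]
  have ab: "a$1 = (p * (u\<^sup>2 - v\<^sup>2 + 1) - q * (2 * u * v)) / 2"
    "b$1 = - (q * (u\<^sup>2 - v\<^sup>2 + 1) + p * (2 * u * v)) / 2"
    "a$2 = (q * (u\<^sup>2 - v\<^sup>2 - 1) + p * (2 * u * v)) / 2"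
    "b$2 = (p * (u\<^sup>2 - v\<^sup>2 - 1) - q * (2 * u * v)) / 2"
    "a$3 = - (p * u - q * v)" "b$3 = p * v + q * u"
    using arg_cong[OF c(1), of Re] arg_cong[OF c(1), of Im] arg_cong[OF c(2), of Re]
      arg_cong[OF c(2), of Im] arg_cong[OF c(3), of Re] arg_cong[OF c(3), of Im]
    by (simp_all add: pquv power2_eq_square field_simps)
  have h2: "(cmod h)\<^sup>2 = p\<^sup>2 + q\<^sup>2" by (simp add: pquv cmod_power2)
  have m: "m = u\<^sup>2 + v\<^sup>2 - 1" by (simp add: m_def pquv)
  \<comment> \<open>A rearrangement of \<open>2 (<a,a> + <b,b>) = |h|^2 m^2\<close>; the last
    difference vanishes by conformality.\<close>
  have "4 * minner a a = (p\<^sup>2 + q\<^sup>2) * m\<^sup>2 + 2 * (minner a a - minner b b)"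
    unfolding minner_def ab m by (simp add: field_simps) algebra
  then show E: "4 * E = (cmod h)\<^sup>2 * m\<^sup>2" by (simp add: conformal h2)
  then show m0: "m \<noteq> 0" using E_pos by auto
  have "4 * (mcross a b $ 1) = (p\<^sup>2 + q\<^sup>2) * m * (2 * u)"
    "4 * (mcross a b $ 2) = (p\<^sup>2 + q\<^sup>2) * m * (2 * v)"
    "4 * (mcross a b $ 3) = - (p\<^sup>2 + q\<^sup>2) * m * (m + 2)"
    unfolding mcross_nth ab m by (simp add: field_simps, algebra)+
  then have *: "4 * E * n$1 = (p\<^sup>2 + q\<^sup>2) * m * (2 * u)"
    "4 * E * n$2 = (p\<^sup>2 + q\<^sup>2) * m * (2 * v)"
    "4 * E * n$3 = - (p\<^sup>2 + q\<^sup>2) * m * (m + 2)"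
    by (simp_all add: normal)
  have "(p\<^sup>2 + q\<^sup>2) * m \<noteq> 0" using m0 \<open>h \<noteq> 0\<close> by (simp flip: h2)
  moreover have "(p\<^sup>2 + q\<^sup>2) * m * (m * n$1) = (p\<^sup>2 + q\<^sup>2) * m * (2 * u)"
    "(p\<^sup>2 + q\<^sup>2) * m * (m * n$2) = (p\<^sup>2 + q\<^sup>2) * m * (2 * v)"
    "(p\<^sup>2 + q\<^sup>2) * m * (m * n$3) = (p\<^sup>2 + q\<^sup>2) * m * (- (m + 2))"
    using * unfolding E h2 by algebra+
  ultimately show "m * n$1 = 2 * Re w" "m * n$2 = 2 * Im w" "m * n$3 = - (m + 2)"
    unfolding mult_left_cancel[OF \<open>(p\<^sup>2 + q\<^sup>2) * m \<noteq> 0\<close>] by (simp_all add: pquv)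
qed

text \<open>For \<open>h \<noteq> 0\<close> the relation \<open>m n_3 = -(m + 2)\<close> with
  \<open>n_3 = -1\<close> would read \<open>m = m + 2\<close>. For \<open>h = 0\<close> the third
  components vanish and \<open>a = (b_2, -b_1, 0)\<close>, whose product with \<open>b\<close> is
  \<open>(0, 0, -E)\<close>.\<close>

lemma normal_eq_stereographic_pole_iff: "n = stereographic_pole \<longleftrightarrow> h = 0"
proof
  assume n: "n = stereographic_pole"
  show "h = 0"
  proof (rule ccontr)
    assume "h \<noteq> 0"
    define v where "v = - (Complex (a$3) (- b$3) / h)"
    have n': "n$1 = 0" "n$2 = 0" "n$3 = -1"
      by (simp_all add: n stereographic_pole_def)
    then have "Re v = 0" "Im v = 0" "(Re v)\<^sup>2 + (Im v)\<^sup>2 - 1 = (Re v)\<^sup>2 + (Im v)\<^sup>2 - 1 + 2"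
      using stereographic_normal(3-5)[OF \<open>h \<noteq> 0\<close> v_def] by simp_all
    then show False by simp
  qed
next
  assume "h = 0"
  then have h: "a$1 = b$2" "a$2 = - b$1" by (simp_all add: h_def complex_eq_iff)
  then have "(a$3)\<^sup>2 = (b$3)\<^sup>2" "a$3 * b$3 = 0"
    using conformal by (simp_all add: minner_def power2_eq_square)
  then have "a$3 = 0" "b$3 = 0" by auto
  then have "mcross a b = E *\<^sub>R stereographic_pole"
    using conformal(2) h
    by (simp add: vec_eq_iff forall_3 mcross_nth stereographic_pole_def minner_def)
  then show "n = stereographic_pole" using normal E_pos by simp
qed

end

section \<open>The Weierstrass function of a minimal surface in canonical parameters\<close>

locale canonical_minimal_surface =
  fixes z l :: "complex \<Rightarrow> real^3" and D :: "complex set"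
  assumes surface: "timelike_surface z l D"
    and principal: "principal_parameters z l D"
    and regular: "strongly_regular z D"
    and minimal: "minimal_surface z l D"
    and canonical: "canonical_parameters z l D"
begin

section \<open>The fundamental forms in canonical parameters\<close>

lemma open_domain: "open D"
  using surface by (simp add: timelike_surface_def)

lemma C2: "C2_on z D"
  using surface by (simp add: timelike_surface_def)

lemmas differentiable = C2_onD[OF C2 open_domain]

lemma coeff_E_pos:
  assumes "q \<in> D" shows "coeff_E z q > 0"
proof -
  have "\<forall>a b::real. (a, b) \<noteq> (0, 0) \<longrightarrow>
        coeff_E z q * a\<^sup>2 + 2 * coeff_F z q * a * b + coeff_G z q * b\<^sup>2 > 0"
    using surface assms by (simp add: timelike_surface_def)
  from this[rule_format, of 1 0] show ?thesis by simp
qed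

lemma coeff_G: "q \<in> D \<Longrightarrow> coeff_G z q = coeff_E z q"
  using canonical by (simp add: canonical_parameters_def coeff_E_def coeff_G_def)

lemma coeff_F: "q \<in> D \<Longrightarrow> coeff_F z q = 0"
  using principal by (simp add: principal_parameters_def)

lemma coeff_f: "q \<in> D \<Longrightarrow> coeff_f z l q = 0"
  using principal by (simp add: principal_parameters_def)

lemma coeff_e:
  assumes "q \<in> D" shows "coeff_e z l q = 1"
proof -
  have "coeff_E z q = 1 / nu1 z l q"
    using canonical assms by (simp add: canonical_parameters_def coeff_E_def)
  \<comment> \<open>\<open>E = 1 / nu1 = E / e\<close>. The case \<open>e = 0\<close> would force
    \<open>E = 0\<close>, since division by zero yields 0.\<close>
  then show ?thesis
    using coeff_E_pos[OF assms] by (cases "coeff_e z l q = 0") (auto simp: nu1_def field_simps)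
qed

lemma coeff_g:
  assumes "q \<in> D" shows "coeff_g z l q = - 1"
proof -
  have "nu1 z l q + nu2 z l q = 0"
    using minimal assms by (simp add: minimal_surface_def)
  then show ?thesis
    using coeff_E_pos[OF assms] coeff_e[OF assms] coeff_G[OF assms]
    by (simp add: nu1_def nu2_def field_simps)
qed

text \<open>The orientation of the frame enters here: it fixes the sign of \<open>l\<close>, and
  with it the pole that corresponds to infinite \<open>w\<close>.\<close>

lemma mcross_eq_normal:
  assumes "q \<in> D" shows "mcross (pdx z q) (pdy z q) = coeff_E z q *\<^sub>R l q"
proof -
  have "mcross (frame_X z q) (frame_Y z q) = l q"
    using principal assms by (simp add: principal_parameters_def positively_oriented_frame_def)
  then have "(1 / coeff_E z q) *\<^sub>R mcross (pdx z q) (pdy z q) = l q"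
    using coeff_E_pos[OF assms] coeff_G[OF assms] by (simp add: frame_X_def frame_Y_def mcross_scaleR)
  then have "coeff_E z q *\<^sub>R l q = coeff_E z q *\<^sub>R ((1 / coeff_E z q) *\<^sub>R mcross (pdx z q) (pdy z q))"
    by simp
  then show ?thesis
    using coeff_E_pos[OF assms] by simp
qed

section \<open>Harmonicity of the surface and its holomorphic isotropic curve\<close>

lemma mixed_partials: "q \<in> D \<Longrightarrow> pdy (pdx z) q = pdx (pdy z) q"
  by (rule mixed_partials_commute[OF open_domain _ C2])

lemma coeff_E_partials:
  assumes "q \<in> D"
  shows "coeff_E z differentiable (at q)"
    and "pdx (coeff_E z) q = 2 * minner (pdx (pdx z) q) (pdx z q)"
    and "pdy (coeff_E z) q = 2 * minner (pdy (pdx z) q) (pdx z q)"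
  using partials_minner[OF differentiable(2)[OF assms] differentiable(2)[OF assms]]
  by (simp_all add: coeff_E_def[abs_def] minner_def mult.commute)

text \<open>Differentiating \<open>E = G\<close> and \<open>F = 0\<close> and using
  \<open>z_xy = z_yx\<close> shows that \<open>z_xx + z_yy\<close> is orthogonal to both tangent
  vectors. Its product with \<open>l\<close> is \<open>e + g = 0\<close>, so it is orthogonal to a
  whole frame.\<close>

lemma harmonic:
  assumes "q \<in> D" shows "pdx (pdx z) q + pdy (pdy z) q = 0"
proof (rule minner_orthogonal_frame_eq_0[of _ "pdx z q" "pdy z q"])
  note dx = differentiable(2)[OF assms] and dy = differentiable(3)[OF assms]
  have G: "pdx (coeff_G z) q = 2 * minner (pdx (pdy z) q) (pdy z q)"
      "pdy (coeff_G z) q = 2 * minner (pdy (pdy z) q) (pdy z q)"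
    using partials_minner[OF dy dy] by (simp_all add: coeff_G_def[abs_def] minner_def mult.commute)
  have F: "pdx (coeff_F z) q = minner (pdx z q) (pdx (pdy z) q) + minner (pdx (pdx z) q) (pdy z q)"
      "pdy (coeff_F z) q = minner (pdx z q) (pdy (pdy z) q) + minner (pdy (pdx z) q) (pdy z q)"
    using partials_minner[OF dx dy] by (simp_all add: coeff_F_def[abs_def])
  have "pdx (coeff_F z) q = pdx (\<lambda>_. 0) q" "pdy (coeff_F z) q = pdy (\<lambda>_. 0) q"
    by (rule partials_cong[OF open_domain assms coeff_F]; assumption)+
  then have F0: "pdx (coeff_F z) q = 0" "pdy (coeff_F z) q = 0"
    by (simp_all add: pdx_def pdy_def)
  have "pdx (coeff_G z) q = pdx (coeff_E z) q" "pdy (coeff_G z) q = pdy (coeff_E z) q"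
    by (rule partials_cong[OF open_domain assms coeff_G]; assumption)+
  then show "minner (pdx (pdx z) q + pdy (pdy z) q) (pdx z q) = 0"
      "minner (pdx (pdx z) q + pdy (pdy z) q) (pdy z q) = 0"
    using F F0 G coeff_E_partials(2,3)[OF assms] mixed_partials[OF assms]
    by (simp_all add: minner_def algebra_simps)
  have "minner (pdx (pdx z) q + pdy (pdy z) q) (l q) = 0"
    using coeff_e[OF assms] coeff_g[OF assms]
    by (simp add: coeff_e_def coeff_g_def minner_def algebra_simps)
  then show "minner (pdx (pdx z) q + pdy (pdy z) q) (mcross (pdx z q) (pdy z q)) = 0"
    by (simp add: mcross_eq_normal[OF assms] bounded_bilinear.scaleR_right[OF bounded_bilinear_minner])
  show "minner (mcross (pdx z q) (pdy z q)) (mcross (pdx z q) (pdy z q)) \<noteq> 0"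
    using coeff_F[OF assms] coeff_G[OF assms] coeff_E_pos[OF assms]
    by (simp add: minner_mcross_self coeff_E_def coeff_F_def coeff_G_def)
qed

text \<open>Twice the Wirtinger derivative of the coordinate \<open>z_j\<close>.\<close>

definition \<phi> :: "3 \<Rightarrow> complex \<Rightarrow> complex" where
  "\<phi> j q = Complex (pdx z q $ j) (- pdy z q $ j)"

text \<open>The complex derivative of a holomorphic function equals its
  \<open>x\<close>-derivative.\<close>

definition \<phi>' :: "3 \<Rightarrow> complex \<Rightarrow> complex" where
  "\<phi>' j q = Complex (pdx (pdx z) q $ j) (- pdx (pdy z) q $ j)"

text \<open>For the real part \<open>z_x\<close> and the imaginary part \<open>- z_y\<close> the
  Cauchy-Riemann equations are harmonicity and the symmetry of the mixed partials.\<close>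

lemma has_field_derivative_isotropic_curve:
  assumes "q \<in> D" shows "(\<phi> j has_field_derivative \<phi>' j q) (at q)"
proof -
  have L: "bounded_linear (\<lambda>v. v $ j :: real)" "bounded_linear (\<lambda>v. - v $ j :: real)"
    for j :: 3
    by (auto intro: bounded_linear_minus)
  note X = partials_bounded_linear[OF L(1)[of j] differentiable(2)[OF assms]]
  note Y = partials_bounded_linear[OF L(2)[of j] differentiable(3)[OF assms]]
  have "pdy (pdy z) q = - pdx (pdx z) q"
    using harmonic[OF assms] by (simp add: eq_neg_iff_add_eq_0 add.commute)
  with Cauchy_Riemann_has_field_derivative[OF X(1) Y(1)] show ?thesis
    using mixed_partials[OF assms] unfolding X Y
    by (simp add: \<phi>_def[abs_def] \<phi>'_def)
qed

lemma complex_gradient_eq: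
  assumes "q \<in> D" shows "complex_gradient (\<lambda>q. z q $ j) q = \<phi> j q"
  using partials_bounded_linear(2,3)[OF bounded_linear_vec_nth differentiable(1)[OF assms]]
  by (simp add: complex_gradient_def \<phi>_def complex_eq_iff)

section \<open>The Weierstrass function and its derivative\<close>

definition denominator :: "complex \<Rightarrow> complex" where
  "denominator q = \<phi> 1 q - \<i> * \<phi> 2 q"

definition Weierstrass_function :: "complex \<Rightarrow> complex" where
  "Weierstrass_function q = - (\<phi> 3 q / denominator q)"


lemma conformal:
  assumes "q \<in> D"
  shows "minner (pdx z q) (pdx z q) = coeff_E z q" "minner (pdy z q) (pdy z q) = coeff_E z q"
    "minner (pdx z q) (pdy z q) = 0"
  using coeff_G[OF assms] coeff_F[OF assms] by (simp_all add: coeff_E_def coeff_F_def coeff_G_def)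

text \<open>Brings the denominator into the shape that the pointwise frame lemmas require of
  \<open>h\<close>.\<close>

lemma denominator_eq:
  "denominator q = Complex (pdx z q $ 1) (- pdy z q $ 1) - \<i> * Complex (pdx z q $ 2) (- pdy z q $ 2)"
  by (simp add: denominator_def \<phi>_def)

lemma Weierstrass_function_eq:
  "Weierstrass_function q = - (Complex (pdx z q $ 3) (- pdy z q $ 3) / denominator q)"
  by (simp add: Weierstrass_function_def \<phi>_def)

context
  fixes q
  assumes q: "q \<in> D"
begin

lemmas isotropic_curve_isotropic =
  isotropic[OF conformal[OF q] coeff_E_pos[OF q] mcross_eq_normal[OF q] denominator_eq, folded \<phi>_def]

lemmas isotropic_curve_components =
  stereographic_components[OF conformal[OF q] coeff_E_pos[OF q] mcross_eq_normal[OF q] denominator_eq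
    _ Weierstrass_function_eq, folded \<phi>_def]

lemmas normal_components =
  stereographic_normal[OF conformal[OF q] coeff_E_pos[OF q] mcross_eq_normal[OF q] denominator_eq
    _ Weierstrass_function_eq]

lemmas normal_eq_pole_iff =
  normal_eq_stereographic_pole_iff[OF conformal[OF q] coeff_E_pos[OF q] mcross_eq_normal[OF q] denominator_eq]

end

text \<open>Half the derivative of the isotropy relation, which holds on all of the open set
  \<open>D\<close>.\<close>

lemma isotropic_curve_deriv_orthogonal:
  assumes "q \<in> D" shows "\<phi> 1 q * \<phi>' 1 q + \<phi> 2 q * \<phi>' 2 q = \<phi> 3 q * \<phi>' 3 q"
proof -
  note d = has_field_derivative_isotropic_curve[OF assms]
  have "((\<lambda>q. (\<phi> 1 q)\<^sup>2 + (\<phi> 2 q)\<^sup>2) has_field_derivative 2 * \<phi> 1 q * \<phi>' 1 q + 2 * \<phi> 2 q * \<phi>' 2 q) (at q)"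
    by (auto intro!: derivative_eq_intros d)
  moreover have "((\<lambda>q. (\<phi> 3 q)\<^sup>2) has_field_derivative 2 * \<phi> 3 q * \<phi>' 3 q) (at q)"
    by (auto intro!: derivative_eq_intros d)
  then have "((\<lambda>q. (\<phi> 1 q)\<^sup>2 + (\<phi> 2 q)\<^sup>2) has_field_derivative 2 * \<phi> 3 q * \<phi>' 3 q) (at q)"
    by (rule has_field_derivative_transform_within_open[OF _ open_domain assms])
      (simp add: isotropic_curve_isotropic)
  ultimately have "2 * \<phi> 1 q * \<phi>' 1 q + 2 * \<phi> 2 q * \<phi>' 2 q = 2 * \<phi> 3 q * \<phi>' 3 q"
    by (rule DERIV_unique)
  then have "2 * (\<phi> 1 q * \<phi>' 1 q + \<phi> 2 q * \<phi>' 2 q) = 2 * (\<phi> 3 q * \<phi>' 3 q)"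
    by (simp only: distrib_left mult.assoc)
  then show ?thesis by (simp only: mult_cancel_left) simp
qed

text \<open>The left-hand side is \<open>e - i f\<close>, so this is where the parameters being canonical enters.\<close>

lemma isotropic_curve_deriv_normal:
  assumes "q \<in> D"
  shows "\<phi>' 1 q * of_real (l q $ 1) + \<phi>' 2 q * of_real (l q $ 2) - \<phi>' 3 q * of_real (l q $ 3) = 1"
  using coeff_e[OF assms] coeff_f[OF assms] mixed_partials[OF assms]
  by (simp add: complex_eq_iff \<phi>'_def coeff_e_def coeff_f_def minner_def)

text \<open>Orthogonality of \<open>\<phi>'\<close> to \<open>\<phi>\<close> eliminates the
  derivative of \<open>\<phi> 1 + \<i> * \<phi> 2\<close>, after which the normal relation becomes
  \<open>w * h' + k' = - 1\<close>. The quotient rule gives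
  \<open>w' = - (w * h' + k') / h\<close>.\<close>

lemma Weierstrass_function_has_derivative:
  assumes "q \<in> D" "denominator q \<noteq> 0"
  shows "(Weierstrass_function has_field_derivative 1 / denominator q) (at q)"
proof -
  define w h h' k' m where "w = Weierstrass_function q" "h = denominator q"
    "h' = \<phi>' 1 q - \<i> * \<phi>' 2 q" "k' = \<phi>' 3 q" "m = (Re w)\<^sup>2 + (Im w)\<^sup>2 - 1"
  note defs = this
  \<comment> \<open>The derivative of \<open>\<phi> 1 + \<i> * \<phi> 2\<close>; together with
    \<open>h'\<close> it determines the first two components of \<open>\<phi>'\<close>.\<close>
  define H' where "H' = \<phi>' 1 q + \<i> * \<phi>' 2 q"
  have h0: "h \<noteq> 0" using assms by (simp add: defs)
  note n = normal_components[OF assms(1,2)]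
  note c = isotropic_curve_components[OF assms(1,2)]
  note d = has_field_derivative_isotropic_curve[OF assms(1)]
  have k: "\<phi> 3 q = - (h * w)" using c(3) by (simp add: defs)
  have \<phi>'12: "\<phi>' 1 q = (h' + H') / 2" "\<phi>' 2 q = \<i> / 2 * (h' - H')"
    by (simp_all add: defs H'_def algebra_simps)
  have "h * (H' + w\<^sup>2 * h') = 2 * (\<phi> 1 q * \<phi>' 1 q + \<phi> 2 q * \<phi>' 2 q)"
    unfolding c(1,2) \<phi>'12 defs(1)[symmetric] defs(2)[symmetric]
    by (simp add: field_simps power2_eq_square)
  also have "\<dots> = h * (- 2 * w * k')"
    unfolding isotropic_curve_deriv_orthogonal[OF assms(1)] k by (simp add: defs)
  finally have "H' + w\<^sup>2 * h' = - 2 * w * k'"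
    unfolding mult_left_cancel[OF h0] .
  then have H': "H' = - 2 * w * k' - w\<^sup>2 * h'"
    by (simp add: algebra_simps)
  have m: "complex_of_real m = w * cnj w - 1"
    by (simp add: defs complex_eq_iff power2_eq_square)
  have "m \<noteq> 0" using n(2) by (simp add: defs)
  have l: "complex_of_real m * of_real (l q $ 1) = w + cnj w"
    "\<i> * (complex_of_real m * of_real (l q $ 2)) = w - cnj w"
    "complex_of_real m * of_real (l q $ 3) = - (complex_of_real m + 2)"
    using n(3-5) by (simp_all add: defs complex_eq_iff flip: of_real_mult)
  \<comment> \<open>The factor \<open>m\<close> clears the denominators in the stereographic formula
    for \<open>l\<close>. Eliminating \<open>H'\<close> then brings out the common factor
    \<open>m = |w|^2 - 1\<close>, which is nonzero.\<close>
  have "2 * complex_of_real m = 2 * complex_of_real m *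
      (\<phi>' 1 q * of_real (l q $ 1) + \<phi>' 2 q * of_real (l q $ 2) - \<phi>' 3 q * of_real (l q $ 3))"
    by (simp add: isotropic_curve_deriv_normal[OF assms(1)])
  also have "\<dots> = (h' + H') * (of_real m * of_real (l q $ 1)) + (h' - H') * (\<i> * (of_real m * of_real (l q $ 2)))
      - 2 * k' * (of_real m * of_real (l q $ 3))"
    unfolding \<phi>'12 defs(4)[symmetric] by (simp add: field_simps)
  also have "\<dots> = - 2 * complex_of_real m * (w * h' + k')"
    unfolding l H' unfolding m by (simp add: algebra_simps power2_eq_square)
  finally have "2 * complex_of_real m * (- 1) = 2 * complex_of_real m * (w * h' + k')"
    by algebra
  then have *: "w * h' + k' = - 1"
    using \<open>m \<noteq> 0\<close> by (simp only: mult_cancel_left) simp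
  have "(denominator has_field_derivative h') (at q)"
    unfolding denominator_def[abs_def] defs(3) by (intro DERIV_diff DERIV_cmult d)
  from DERIV_minus[OF DERIV_divide[OF d[of 3] this assms(2)]]
  have "(Weierstrass_function has_field_derivative
      - ((k' * h - \<phi> 3 q * h') / (h * h))) (at q)"
    by (simp only: Weierstrass_function_def[abs_def] defs(2,4))
  moreover have "- ((k' * h - \<phi> 3 q * h') / (h * h)) = - (w * h' + k') / h"
    using h0 by (simp add: k field_simps)
  ultimately show ?thesis by (simp only: * defs(2) minus_minus)
qed

text \<open>Since \<open>h = 1 / w'\<close>, the stereographic form of the isotropic curve is
  already the representation, with the same \<open>w\<close> for every such
  \<open>U\<close>.\<close>

lemma Weierstrass_representation:
  assumes "open U" "U \<subseteq> D" "\<And>q. q \<in> U \<Longrightarrow> denominator q \<noteq> 0"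
  shows "canonical_representation z Weierstrass_function U"
proof -
  have D: "q \<in> D" if "q \<in> U" for q using that assms(2) by auto
  note w' = Weierstrass_function_has_derivative[OF D assms(3)]
  note n = normal_components[OF D assms(3)]
  note c = isotropic_curve_components[OF D assms(3)]
  have mu: "mu Weierstrass_function q = 1 / (4 * coeff_E z q)" if "q \<in> U" for q
  proof -
    \<comment> \<open>The gradient of \<open>Re w\<close> is \<open>(Re w', - Im w')\<close> with
      \<open>w' = 1 / h\<close>, so \<open>mu\<close> is \<open>1 / (|h|^2 m^2)\<close>, and
      \<open>|h|^2 m^2 = 4 E\<close>.\<close>
    have "(Re (1 / denominator q))\<^sup>2 + (- Im (1 / denominator q))\<^sup>2 = 1 / (cmod (denominator q))\<^sup>2"
      by (simp add: cmod_power2[symmetric] norm_divide power_divide)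
    then show ?thesis
      unfolding mu_def has_field_derivative_partials_Re[OF w'[OF that that]] n(1)[OF that that]
      by simp
  qed
  show ?thesis
    unfolding canonical_representation_def
  proof (intro conjI ballI)
    show "Weierstrass_function holomorphic_on U"
      using w' by (auto simp: holomorphic_on_open[OF assms(1)])
    fix p assume p: "p \<in> U"
    show "(Re (Weierstrass_function p))\<^sup>2 + (Im (Weierstrass_function p))\<^sup>2 - 1 \<noteq> 0"
      by (rule n(2)[OF p p])
    have E: "coeff_E z p > 0" by (rule coeff_E_pos[OF D[OF p]])
    then show "mu Weierstrass_function p > 0" by (simp add: mu p)
    have "(\<lambda>q. 4 * coeff_E z q) differentiable (at p)"
      "pdx (\<lambda>q. 4 * coeff_E z q) p = 4 * pdx (coeff_E z) p"
      "pdy (\<lambda>q. 4 * coeff_E z q) p = 4 * pdy (coeff_E z) p"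
      using partials_bounded_linear[OF bounded_linear_mult_right coeff_E_partials(1)[OF D[OF p]]] by auto
    moreover have "pdx (mu Weierstrass_function) p = pdx (\<lambda>q. 1 / (4 * coeff_E z q)) p"
      "pdy (mu Weierstrass_function) p = pdy (\<lambda>q. 1 / (4 * coeff_E z q)) p"
      by (rule partials_cong[OF assms(1) p mu]; assumption)+
    moreover have "pdx (coeff_G z) p = pdx (coeff_E z) p"
      by (rule partials_cong[OF open_domain D[OF p] coeff_G])
    moreover have "gamma1 z p * gamma2 z p \<noteq> 0"
      using regular D[OF p] by (simp add: strongly_regular_def)
    \<comment> \<open>\<open>mu_x = - E_x / (4 E^2)\<close>, and likewise in \<open>y\<close>. As
      \<open>G_x = E_x\<close>, strong regularity says that \<open>E_x\<close> and
      \<open>E_y\<close> are nonzero.\<close>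
    ultimately show "pdx (mu Weierstrass_function) p * pdy (mu Weierstrass_function) p \<noteq> 0"
      using E by (simp add: partials_inverse gamma1_def gamma2_def)
    have "deriv Weierstrass_function p = 1 / denominator p"
      by (rule DERIV_imp_deriv[OF w'[OF p p]])
    then show "complex_gradient (\<lambda>q. z q $ 1) p
          = 1 / 2 * (((Weierstrass_function p)\<^sup>2 + 1) / deriv Weierstrass_function p)"
      "complex_gradient (\<lambda>q. z q $ 2) p
          = - (\<i> / 2) * (((Weierstrass_function p)\<^sup>2 - 1) / deriv Weierstrass_function p)"
      "complex_gradient (\<lambda>q. z q $ 3) p = - (Weierstrass_function p / deriv Weierstrass_function p)"
      using c[OF p p] by (simp_all add: complex_gradient_eq[OF D[OF p]] mult_ac)
  qed
qed

section \<open>Local representation away from the stereographic pole and at it\<close>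

lemma continuous_isotropic_curve: "q \<in> D \<Longrightarrow> isCont (\<phi> j) q"
  by (rule DERIV_isCont[OF has_field_derivative_isotropic_curve])

text \<open>The denominator is nonzero at \<open>p\<close> because \<open>l p\<close> is not the
  pole, and by continuity the set where it is nonzero is open.\<close>

lemma local_representation:
  assumes p: "p \<in> D" "l p \<noteq> stereographic_pole"
  shows "\<exists>U w. open U \<and> p \<in> U \<and> U \<subseteq> D \<and> canonical_representation z w U"
proof -
  define U where "U = {q \<in> D. denominator q \<in> - {0}}"
  have "continuous_on D denominator"
    unfolding denominator_def[abs_def]
    by (intro continuous_at_imp_continuous_on ballI continuous_intros continuous_isotropic_curve)
  then have "open U"
    using continuous_open_preimage[OF _ open_domain, of denominator "- {0}"]
    by (auto simp: U_def vimage_def Int_def)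
  moreover have "p \<in> U"
    using p normal_eq_pole_iff[of p] by (auto simp: U_def)
  moreover have "U \<subseteq> D" by (auto simp: U_def)
  moreover have "canonical_representation z Weierstrass_function U"
    using \<open>open U\<close> by (rule Weierstrass_representation) (auto simp: U_def)
  ultimately show ?thesis by blast
qed

text \<open>Near \<open>p\<close>, but not at \<open>p\<close>, \<open>\<phi> 3\<close> is nonzero.
  Isotropy then keeps the denominator nonzero, so the representation holds on a punctured
  neighbourhood.\<close>

lemma local_representation_pole:
  assumes p: "p \<in> D" "l p = stereographic_pole"
  shows "\<exists>U w. open U \<and> p \<in> U \<and> U \<subseteq> D \<and> is_pole w p \<and> canonical_representation z w (U - {p})"
proof -
  have h0: "denominator p = 0" using p normal_eq_pole_iff[of p] by auto
  have isotropic': "denominator q * (\<phi> 1 q + \<i> * \<phi> 2 q) = (\<phi> 3 q)\<^sup>2" if "q \<in> D" for q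
    using isotropic_curve_isotropic[of q] that
    by (simp add: denominator_def power2_eq_square algebra_simps)
  from isotropic'[OF p(1)] h0 have k0: "\<phi> 3 p = 0" by simp
  \<comment> \<open>For \<open>l p = (0, 0, -1)\<close> the normal relation reduces to its third
    term.\<close>
  have k': "\<phi>' 3 p = 1"
    using isotropic_curve_deriv_normal[OF p(1)] by (simp add: p(2) stereographic_pole_def)
  \<comment> \<open>Otherwise all three components of \<open>\<phi>\<close> vanish at
    \<open>p\<close>, so \<open>z_x = 0\<close> there, against \<open>E > 0\<close>.\<close>
  have H0: "\<phi> 1 p + \<i> * \<phi> 2 p \<noteq> 0"
  proof
    assume "\<phi> 1 p + \<i> * \<phi> 2 p = 0"
    with h0 have "\<phi> 1 p = 0" by (simp add: denominator_def)
    moreover from this h0 have "\<phi> 2 p = 0" by (simp add: denominator_def)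
    ultimately have "pdx z p = 0"
      using k0 by (simp add: \<phi>_def complex_eq_iff vec_eq_iff forall_3)
    then show False using coeff_E_pos[OF p(1)] by (simp add: coeff_E_def minner_def)
  qed
  have "((\<lambda>q. (\<phi> 3 q - \<phi> 3 p) / (q - p)) \<longlongrightarrow> 1) (at p)"
    using has_field_derivative_isotropic_curve[OF p(1), of 3] by (simp add: has_field_derivative_iff k')
  then have "\<forall>\<^sub>F q in at p. (\<phi> 3 q - \<phi> 3 p) / (q - p) \<noteq> 0"
    by (rule tendsto_imp_eventually_ne) simp
  then have "\<forall>\<^sub>F q in at p. \<phi> 3 q \<noteq> 0"
    by eventually_elim (auto simp: k0)
  moreover have "\<forall>\<^sub>F q in at p. q \<in> D"
    using open_domain p(1) by (rule eventually_at_in_open')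
  ultimately have ev: "\<forall>\<^sub>F q in at p. \<phi> 3 q \<noteq> 0 \<and> q \<in> D"
    by (rule eventually_conj)
  then obtain U where U: "open U" "p \<in> U" "\<And>q. q \<in> U \<Longrightarrow> q \<noteq> p \<Longrightarrow> \<phi> 3 q \<noteq> 0 \<and> q \<in> D"
    by (auto simp: eventually_at_topological)
  have nz: "denominator q \<noteq> 0" if "\<phi> 3 q \<noteq> 0" "q \<in> D" for q
    using isotropic'[OF that(2)] that(1) by auto
  have "is_pole (\<lambda>q. - (\<phi> 1 q + \<i> * \<phi> 2 q) / \<phi> 3 q) p"
  proof (rule is_pole_divide)
    show "isCont (\<lambda>q. - (\<phi> 1 q + \<i> * \<phi> 2 q)) p"
      by (intro continuous_intros continuous_isotropic_curve p(1))
    have "(\<phi> 3 \<longlongrightarrow> 0) (at p)"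
      using continuous_isotropic_curve[OF p(1), of 3] by (simp add: isCont_def k0)
    then show "filterlim (\<phi> 3) (at 0) (at p)"
      using ev by (auto simp: filterlim_at elim: eventually_mono)
    show "- (\<phi> 1 p + \<i> * \<phi> 2 p) \<noteq> 0" using H0 by (simp only: neg_equal_0_iff_equal not_False_eq_True)
  qed
  \<comment> \<open>Isotropy in the form
    \<open>h * (\<phi> 1 + \<i> * \<phi> 2) = (\<phi> 3)^2\<close> identifies the two
    quotients.\<close>
  moreover have "\<forall>\<^sub>F q in at p. - (\<phi> 1 q + \<i> * \<phi> 2 q) / \<phi> 3 q = Weierstrass_function q"
    using ev
  proof eventually_elim
    case (elim q)
    with isotropic'[of q] nz[of q] show ?case
      by (simp add: Weierstrass_function_def power2_eq_square divide_simps) (simp add: algebra_simps)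
  qed
  ultimately have "is_pole Weierstrass_function p"
    by (rule is_pole_transform) simp
  moreover have "canonical_representation z Weierstrass_function (U - {p})"
    using U nz by (intro Weierstrass_representation open_delete) auto
  moreover have "U \<subseteq> D" using U p(1) by blast
  ultimately show ?thesis using U by blast
qed

end

theorem theorem1:
  fixes z l :: "complex \<Rightarrow> real^3" and D :: "complex set"
  assumes "timelike_surface z l D"
    and "principal_parameters z l D"
    and "strongly_regular z D"
    and "minimal_surface z l D"
    and "canonical_parameters z l D"
  shows "\<forall>p\<in>D.
    (l p \<noteq> stereographic_pole \<longrightarrow>
       (\<exists>U w. open U \<and> p \<in> U \<and> U \<subseteq> D \<and> canonical_representation z w U)) \<and>
    (l p = stereographic_pole \<longrightarrow>
       (\<exists>U w. open U \<and> p \<in> U \<and> U \<subseteq> D \<and> is_pole w p \<and> canonical_representation z w (U - {p})))"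
proof -
  interpret canonical_minimal_surface z l D
    by unfold_locales (fact assms)+
  show ?thesis
    using local_representation local_representation_pole by blast
qed

end
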